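(* Let $z_1,\dots,z_J$ be distinct points of the unit circle, $\phi(z)=\prod_{j=1}^J(1-\overline{z_j}z)$, and let $(a_n)_{n\ge0}$ be a sequence of complex numbers with $a_n\ne1$ for all $n$. Let $H(K)$ be the reproducing kernel Hilbert space with orthonormal basis $f_n(z)=\phi(a_nz)z^n$, $n\ge0$. If $p>1/2$ and $\lim_{n\to\infty}n(1-a_n)=p$, then $H(K)$ contains the polynomials.
   Context: $J\ge1$ is an integer. $K(z,\zeta)=\sum_{n=0}^\infty f_n(z)\overline{f_n(\zeta)}$ is the kernel of $H(K)$, and the elements of $H(K)$ are the functions $f=\sum_n\alpha_nf_n$ with $(\alpha_n)\in\ell^2$ and $\|f\|=\|(\alpha_n)\|_{\ell^2}$; they are analytic on the open unit disc $\mathbb{D}$ and are identified with their restrictions to $\mathbb{D}$. Polynomials are polynomials in $z$ with complex coefficients. *)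

theory Defs
  imports "HOL-Analysis.Analysis" "HOL-Computational_Algebra.Polynomial"
begin

definition phi :: "nat \<Rightarrow> (nat \<Rightarrow> complex) \<Rightarrow> complex \<Rightarrow> complex" where
  "phi J z w = (\<Prod>j=1..J. 1 - cnj (z j) * w)"

definition basis_fun ::
  "nat \<Rightarrow> (nat \<Rightarrow> complex) \<Rightarrow> (nat \<Rightarrow> complex) \<Rightarrow> nat \<Rightarrow> complex \<Rightarrow> complex" where
  "basis_fun J z a n w = phi J z (a n * w) * w ^ n"

text \<open>
  The underlying set of the reproducing kernel Hilbert space with kernel
  $K(z,\zeta) = \sum_n f_n(z)\, \overline{f_n(\zeta)}$ and orthonormal basis $(f_n)$:
  the functions $\sum_n \alpha_n f_n$ with $(\alpha_n)$ square summable. Its elements are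
  identified with their restrictions to the open unit disc, so they are taken to be
  \<^const>\<open>extensional\<close> there. Since point evaluations are continuous on the Hilbert space,
  the expansion converges pointwise.
\<close>

definition HK :: "(nat \<Rightarrow> complex \<Rightarrow> complex) \<Rightarrow> (complex \<Rightarrow> complex) set" where
  "HK f = {g \<in> extensional (ball 0 1). \<exists>\<alpha>::nat \<Rightarrow> complex.
     summable (\<lambda>n. (norm (\<alpha> n))\<^sup>2) \<and> (\<forall>w\<in>ball 0 1. (\<lambda>n. \<alpha> n * f n w) sums g w)}"

end

theory Submission
  imports
    Defs
    "HOL-Computational_Algebra.Polynomial_FPS"
    "HOL-Real_Asymp.Real_Asymp"
begin

text \<open>
  Write $\phi(w) = \sum_k c_k w^k$, so that $c_0 = 1$. Comparing coefficients of $w^n$ in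
  $q = \sum_n \alpha_n f_n$ gives the triangular system
  $\sum_{k \le n} c_k\, a_{n-k}^k\, \alpha_{n-k} = q_n$, which always has exactly one solution.
  The whole question is whether that solution is square summable.

  Since $a_n = 1 - p/n + o(1/n)$, one has $a_{n-k}^k = (n-k)^p/n^p + o(1/n)$ for each fixed $k$. Hence
  the rescaled sequence $x_n = (n+1)^p \alpha_n$ solves the constant coefficient recurrence
  $\sum_k c_k x_{n-k} = 0$ up to a relative error $o(1/n)$ (for large $n$, where $q_n = 0$).
  The unperturbed recurrence has only bounded solutions, because the zeros of $\phi$ are simple
  and unimodular: by partial fractions, $1/\phi$ has bounded Taylor coefficients
  (\<open>bounded_reciprocal_of_unimodular_roots\<close>). A perturbation of relative size $\varepsilon/n$
  can multiply the bound by at most $1 + O(\varepsilon)/n$ in each step, so a discrete Gronwall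
  argument (\<open>perturbed_recurrence_growth\<close>) gives $x_n = O(n^t)$ for every $t > 0$.
  Therefore $\alpha_n = O(n^{t-p})$, which is square summable for small $t$ since $p > 1/2$
  (\<open>square_summable_solution\<close>).

  In the open disc the series $\sum_n \alpha_n f_n$ is a sum of finitely many absolutely convergent
  ones, one for each coefficient of $\phi$, and regrouping by powers of $w$ recovers $q$
  (\<open>triangular_rearrangement_sums\<close>).
\<close>

section \<open>Bounded power series coefficients of the reciprocal\<close>

text \<open>The partial fraction decomposition of $1/((1-cX)(1-dX))$, stated with geometric series.\<close>

lemma geometric_fps_mult:
  fixes c d :: "'a::field"
  assumes "c \<noteq> d"
  shows "Abs_fps (\<lambda>n. c ^ n) * Abs_fps (\<lambda>n. d ^ n) =
    fps_const (c / (c - d)) * Abs_fps (\<lambda>n. c ^ n) - fps_const (d / (c - d)) * Abs_fps (\<lambda>n. d ^ n)"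
proof (rule fps_ext)
  fix n
  have "c ^ Suc n - d ^ Suc n = (c - d) * (\<Sum>i\<le>n. c ^ i * d ^ (n - i))"
    unfolding diff_power_eq_sum lessThan_Suc_atMost[symmetric] by (simp add: mult.commute)
  then have "(\<Sum>i\<le>n. c ^ i * d ^ (n - i)) = (c ^ Suc n - d ^ Suc n) / (c - d)"
    using assms by (simp add: field_simps)
  then have conv: "fps_nth (Abs_fps (\<lambda>n. c ^ n) * Abs_fps (\<lambda>n. d ^ n)) n = (c ^ Suc n - d ^ Suc n) / (c - d)"
    by (simp add: fps_mult_nth atLeast0AtMost)
  show "fps_nth (Abs_fps (\<lambda>n. c ^ n) * Abs_fps (\<lambda>n. d ^ n)) n =
    fps_nth (fps_const (c / (c - d)) * Abs_fps (\<lambda>n. c ^ n) - fps_const (d / (c - d)) * Abs_fps (\<lambda>n. d ^ n)) n"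
    unfolding conv using assms by (simp add: diff_divide_distrib)
qed

lemma partial_fractions_prod_geometric_fps:
  fixes c :: "'i \<Rightarrow> 'a::field"
  assumes "finite I" "I \<noteq> {}" "inj_on c I"
  shows "\<exists>A. (\<Prod>i\<in>I. Abs_fps (\<lambda>n. c i ^ n)) = (\<Sum>i\<in>I. fps_const (A i) * Abs_fps (\<lambda>n. c i ^ n))"
  using assms
proof (induction I rule: finite_ne_induct)
  case (singleton i)
  show ?case by (rule exI[of _ "\<lambda>_. 1"]) simp
next
  case (insert j I)
  define G where "G i = Abs_fps (\<lambda>n. c i ^ n)" for i
  obtain A where A: "(\<Prod>i\<in>I. G i) = (\<Sum>i\<in>I. fps_const (A i) * G i)"
    using insert by (auto simp: G_def)
  \<comment> \<open>Multiplying each term by \<open>G j\<close> splits it into a multiple of \<open>G i\<close> and one of \<open>G j\<close>;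
    the latter are collected in \<open>B j\<close>.\<close>
  define B where "B i = (if i = j then - (\<Sum>i\<in>I. A i * (c j / (c i - c j))) else A i * (c i / (c i - c j)))" for i
  have GG: "G i * G j = fps_const (c i / (c i - c j)) * G i - fps_const (c j / (c i - c j)) * G j" if "i \<in> I" for i
    unfolding G_def using that insert by (intro geometric_fps_mult) (auto simp: inj_on_def)
  have const_sum: "(\<Sum>i\<in>I. fps_const (f i)) = fps_const (\<Sum>i\<in>I. f i)" for f :: "'i \<Rightarrow> 'a"
    by (rule fps_ext) (simp add: fps_sum_nth)
  have "(\<Prod>i\<in>insert j I. G i) = (\<Sum>i\<in>I. fps_const (A i) * (G i * G j))"
    using insert A by (simp add: sum_distrib_left mult_ac)
  also have "\<dots> = (\<Sum>i\<in>I. fps_const (B i) * G i - fps_const (A i * (c j / (c i - c j))) * G j)"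
  proof (rule sum.cong)
    fix i assume i: "i \<in> I"
    with insert have "i \<noteq> j" by auto
    then show "fps_const (A i) * (G i * G j) = fps_const (B i) * G i - fps_const (A i * (c j / (c i - c j))) * G j"
      unfolding GG[OF i] B_def by (simp add: right_diff_distrib mult.assoc[symmetric] del: fps_const_divide times_divide_eq_right)
  qed simp
  also have "\<dots> = (\<Sum>i\<in>I. fps_const (B i) * G i) + fps_const (B j) * G j"
    by (simp add: sum_subtractf B_def sum_distrib_right[symmetric] const_sum flip: fps_const_neg)
  also have "\<dots> = (\<Sum>i\<in>insert j I. fps_const (B i) * G i)"
    using insert by (simp add: add.commute)
  finally show ?case unfolding G_def by blast
qed

text \<open>
  Because the $c_i$ are distinct, the reciprocal is a linear combination of the geometric series
  $\sum_n c_i^n X^n$, whose coefficients have modulus one. A repeated root would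
  produce polynomially growing coefficients instead.
\<close>

lemma bounded_reciprocal_of_unimodular_roots:
  fixes c :: "'i \<Rightarrow> complex"
  assumes "finite I" "I \<noteq> {}" "inj_on c I" "\<And>i. i \<in> I \<Longrightarrow> norm (c i) = 1"
  obtains G C where "fps_of_poly (\<Prod>i\<in>I. [:1, - c i:]) * G = 1" "\<And>n. norm (fps_nth G n) \<le> C"
proof -
  obtain A where A: "(\<Prod>i\<in>I. Abs_fps (\<lambda>n. c i ^ n)) = (\<Sum>i\<in>I. fps_const (A i) * Abs_fps (\<lambda>n. c i ^ n))"
    using partial_fractions_prod_geometric_fps assms by metis
  define G where "G = (\<Prod>i\<in>I. Abs_fps (\<lambda>n. c i ^ n))"
  have "fps_of_poly [:1, - x:] * Abs_fps (\<lambda>n. x ^ n) = 1" for x :: complex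
  proof (rule fps_ext)
    fix n show "fps_nth (fps_of_poly [:1, - x:] * Abs_fps (\<lambda>n. x ^ n)) n = fps_nth 1 n"
      by (cases n) (simp_all add: fps_of_poly_linear' fps_of_poly_pCons algebra_simps)
  qed
  then have 1: "fps_of_poly (\<Prod>i\<in>I. [:1, - c i:]) * G = 1"
    by (simp add: G_def fps_of_poly_prod prod.distrib[symmetric])
  have 2: "norm (fps_nth G n) \<le> (\<Sum>i\<in>I. norm (A i))" for n
  proof -
    have "norm (fps_nth G n) \<le> (\<Sum>i\<in>I. norm (A i * c i ^ n))"
      unfolding G_def A by (simp add: fps_sum_nth norm_sum)
    also have "\<dots> = (\<Sum>i\<in>I. norm (A i))"
      using assms by (intro sum.cong) (auto simp: norm_mult norm_power)
    finally show ?thesis .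
  qed
  show thesis using that 1 2 by blast
qed

section \<open>Growth of solutions of a perturbed recurrence\<close>

text \<open>Compares one factor of the Gronwall product with the ratio of consecutive values of $n^t$.\<close>

lemma one_plus_inverse_le_powr_quotient:
  fixes t :: real
  assumes "t \<ge> 0" "n \<ge> 1"
  shows "1 + t / real (Suc n) \<le> (real (Suc n) / real n) powr t"
proof -
  have "1 + t / real (Suc n) \<le> exp (t / real (Suc n))" by (rule exp_ge_add_one_self)
  also have "1 / real (Suc n) \<le> ln (real (Suc n) / real n)"
  proof -
    have "ln (real n / real (Suc n)) \<le> real n / real (Suc n) - 1"
      using assms by (intro ln_le_minus_one) auto
    also have "\<dots> = - (1 / real (Suc n))" by (simp add: field_simps)
    finally show ?thesis using assms by (simp add: ln_div)
  qed
  then have "exp (t / real (Suc n)) \<le> exp (t * ln (real (Suc n) / real n))"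
    using assms mult_left_mono[of "1 / real (Suc n)" "ln (real (Suc n) / real n)" t] by simp
  also have "\<dots> = (real (Suc n) / real n) powr t"
    using assms by (simp add: powr_def)
  finally show ?thesis .
qed

lemma discrete_gronwall_powr:
  fixes M :: "nat \<Rightarrow> real"
  assumes nonneg: "\<And>n. M n \<ge> 0" and "t \<ge> 0" and "n0 \<ge> 1"
    and growth: "\<And>n. n \<ge> n0 \<Longrightarrow> M (Suc n) \<le> (1 + t / real (Suc n)) * M n"
    and "n \<ge> n0"
  shows "M n \<le> M n0 * real n powr t"
  using \<open>n \<ge> n0\<close>
proof (induction n rule: dec_induct)
  case base
  have "1 \<le> real n0 powr t" using \<open>t \<ge> 0\<close> \<open>n0 \<ge> 1\<close> by (intro ge_one_powr_ge_zero) auto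
  then show ?case using nonneg[of n0] by (simp add: mult_le_cancel_left1)
next
  case (step n)
  have "M (Suc n) \<le> (1 + t / real (Suc n)) * M n" using growth step.hyps by simp
  also have "\<dots> \<le> (real (Suc n) / real n) powr t * (M n0 * real n powr t)"
    using \<open>t \<ge> 0\<close> \<open>n0 \<ge> 1\<close> step nonneg by (intro mult_mono one_plus_inverse_le_powr_quotient) auto
  also have "\<dots> = M n0 * real (Suc n) powr t"
    using \<open>n0 \<ge> 1\<close> step.hyps by (simp add: powr_divide)
  finally show ?case .
qed

text \<open>
  Here \<open>r\<close> perturbs the convolution by \<open>coeff P\<close>. Applying the unperturbed
  convolution to \<open>x\<close> leaves a residual \<open>h\<close>, and convolving \<open>h\<close> with the bounded coefficients
  of $1/P$ gives back \<open>x\<close>; thus the partial sums \<open>M\<close> of the moduli of \<open>h\<close>, scaled by the bound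
  \<open>C\<close>, dominate \<open>x\<close>. Conversely \<open>h\<close> is controlled by earlier values of \<open>x\<close> times $o(1/n)$,
  so \<open>M\<close> satisfies a Gronwall inequality with an exponent as small as desired.
\<close>

lemma perturbed_recurrence_growth:
  fixes P :: "complex poly" and r :: "nat \<Rightarrow> nat \<Rightarrow> complex" and x d :: "nat \<Rightarrow> complex"
  assumes inv: "fps_of_poly P * G = 1" and bdd: "\<And>n. norm (fps_nth G n) \<le> C"
    and r0: "\<And>n. r 0 n = 1"
    and r: "\<And>k. (\<lambda>n. of_nat (n + k) * (r k n - 1)) \<longlonglongrightarrow> 0"
    and rec: "\<And>n. (\<Sum>k\<le>n. coeff P k * r k (n - k) * x (n - k)) = d n"
    and d: "eventually (\<lambda>n. d n = 0) sequentially"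
    and "t > 0"
  obtains K where "\<And>n. norm (x n) \<le> K * real (Suc n) powr t"
proof -
  define h where "h n = (\<Sum>k\<le>n. coeff P k * x (n - k))" for n
  define M where "M n = C * (\<Sum>i\<le>n. norm (h i))" for n
  define B where "B = (\<Sum>k\<le>degree P. norm (coeff P k))"
  have C0: "C \<ge> 0" using bdd[of 0] norm_ge_zero order_trans by blast
  have B0: "B \<ge> 0" by (auto simp: B_def sum_nonneg)
  have M0: "M n \<ge> 0" for n using C0 by (auto simp: M_def sum_nonneg)
  have mono: "M m \<le> M n" if "m \<le> n" for m n
    unfolding M_def using that C0 by (intro mult_left_mono sum_mono2) auto
  have xM: "norm (x n) \<le> M n" for n
  proof -
    have "fps_of_poly P * Abs_fps x = Abs_fps h"
      by (rule fps_ext) (simp add: fps_mult_nth h_def atLeast0AtMost)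
    then have "Abs_fps h * G = (fps_of_poly P * G) * Abs_fps x" by (simp only: mult_ac)
    then have "fps_nth (Abs_fps x) n = fps_nth (Abs_fps h * G) n" using inv by simp
    then have "x n = (\<Sum>i\<le>n. h i * fps_nth G (n - i))"
      by (simp add: fps_mult_nth atLeast0AtMost)
    then have "norm (x n) \<le> (\<Sum>i\<le>n. norm (h i * fps_nth G (n - i)))" by (simp add: norm_sum)
    also have "\<dots> \<le> (\<Sum>i\<le>n. C * norm (h i))"
    proof (rule sum_mono)
      fix i show "norm (h i * fps_nth G (n - i)) \<le> C * norm (h i)"
        using mult_left_mono[OF bdd[of "n - i"], of "norm (h i)"] by (simp add: norm_mult mult.commute)
    qed
    finally show ?thesis by (simp add: M_def sum_distrib_left)
  qed
  \<comment> \<open>The Gronwall exponent will be \<open>C * B * e\<close>, so this choice keeps it at most \<open>t\<close>;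
    adding \<open>1\<close> avoids a division by zero.\<close>
  define e where "e = t / (C * B + 1)"
  have e: "e > 0" using C0 B0 \<open>t > 0\<close> by (simp add: e_def add_nonneg_pos)
  have "C * B * e \<le> t"
  proof -
    have "C * B * e \<le> (C * B + 1) * e" using e by (intro mult_right_mono) auto
    also have "\<dots> = t" using mult_nonneg_nonneg[OF C0 B0] by (simp add: e_def)
    finally show ?thesis .
  qed
  have "eventually (\<lambda>n. norm (of_nat (n + k) * (r k n - 1)) < e) sequentially" for k
    using r[of k] e unfolding tendsto_iff by (simp add: dist_norm)
  then have "eventually (\<lambda>n. \<forall>k\<in>{..degree P}. norm (of_nat (n + k) * (r k n - 1)) < e) sequentially"
    by (intro eventually_ball_finite) auto
  then obtain n1 where n1: "norm (of_nat (n + k) * (r k n - 1)) < e" if "n \<ge> n1" "k \<le> degree P" for n k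
    unfolding eventually_sequentially by auto
  obtain n2 where n2: "d n = 0" if "n \<ge> n2" for n
    using d unfolding eventually_sequentially by auto
  define n0 where "n0 = n1 + n2 + degree P + 1"
  have step: "M (Suc n) \<le> (1 + t / real (Suc n)) * M n" if n: "n \<ge> n0" for n
  proof -
    have summand: "norm (coeff P k * (1 - r k (Suc n - k)) * x (Suc n - k)) \<le> norm (coeff P k) * (e / real (Suc n) * M n)"
      if k: "k \<le> degree P" for k
    proof (cases "k = 0")
      case True
      then show ?thesis using r0 e M0 by simp
    next
      case False
      have "norm (of_nat (Suc n - k + k) * (r k (Suc n - k) - 1)) < e"
        using n k by (intro n1) (auto simp: n0_def)
      then have "real (Suc n) * norm (r k (Suc n - k) - 1) < e"
        using n k by (simp add: n0_def norm_mult del: of_nat_Suc)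
      then have 1: "norm (1 - r k (Suc n - k)) \<le> e / real (Suc n)"
        by (simp add: norm_minus_commute pos_le_divide_eq mult.commute del: of_nat_Suc)
      have "norm (x (Suc n - k)) \<le> M (Suc n - k)" by (rule xM)
      also have "\<dots> \<le> M n" using False by (intro mono) auto
      finally show ?thesis
        using 1 e unfolding norm_mult mult.assoc by (intro mult_left_mono mult_mono) auto
    qed
    have "h (Suc n) = (\<Sum>k\<le>Suc n. coeff P k * (1 - r k (Suc n - k)) * x (Suc n - k))"
      using rec[of "Suc n"] n2[of "Suc n"] n
      by (simp add: h_def algebra_simps sum_subtractf n0_def del: sum.atMost_Suc)
    also have "\<dots> = (\<Sum>k\<le>degree P. coeff P k * (1 - r k (Suc n - k)) * x (Suc n - k))"
      using n by (intro sum.mono_neutral_right) (auto simp: n0_def coeff_eq_0)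
    finally have "norm (h (Suc n)) \<le> (\<Sum>k\<le>degree P. norm (coeff P k) * (e / real (Suc n) * M n))"
      using summand by (auto intro!: sum_norm_le)
    also have "\<dots> = B * (e / real (Suc n) * M n)" unfolding B_def sum_distrib_right ..
    finally have "C * norm (h (Suc n)) \<le> C * (B * (e / real (Suc n) * M n))"
      using C0 by (intro mult_left_mono) auto
    also have "\<dots> = C * B * e * (M n / real (Suc n))" by simp
    also have "\<dots> \<le> t * (M n / real (Suc n))"
      using \<open>C * B * e \<le> t\<close> M0 by (intro mult_right_mono) auto
    finally show ?thesis by (simp add: M_def algebra_simps)
  qed
  have "M n \<le> M n0 * real (Suc n) powr t" for n
  proof (cases "n \<ge> n0")
    case True
    have "M n \<le> M n0 * real n powr t"
      using discrete_gronwall_powr[of M t n0 n] M0 step \<open>t > 0\<close> True by (auto simp: n0_def)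
    also have "\<dots> \<le> M n0 * real (Suc n) powr t"
      using M0 \<open>t > 0\<close> by (intro mult_left_mono powr_mono2) auto
    finally show ?thesis .
  next
    case False
    then have "M n \<le> M n0" by (intro mono) auto
    moreover have "1 \<le> real (Suc n) powr t" using \<open>t > 0\<close> by (intro ge_one_powr_ge_zero) auto
    ultimately show ?thesis using M0[of n0] by (simp add: mult_le_cancel_left1 order_trans)
  qed
  then show thesis using that xM order_trans by blast
qed

section \<open>Square summable coefficients\<close>

lemma tendsto_one_of_first_order_limit:
  fixes a :: "nat \<Rightarrow> complex"
  assumes "(\<lambda>n. of_nat n * (1 - a n)) \<longlonglongrightarrow> L"
  shows "a \<longlonglongrightarrow> 1"
proof -
  have "(\<lambda>n. of_nat n * (1 - a n) * of_real (inverse (real n))) \<longlonglongrightarrow> L * of_real 0"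
    by (intro tendsto_intros assms lim_inverse_n)
  moreover have "eventually (\<lambda>n. of_nat n * (1 - a n) * of_real (inverse (real n)) = 1 - a n) sequentially"
    using eventually_gt_at_top[of 0] by eventually_elim (simp add: field_simps)
  ultimately have "(\<lambda>n. 1 - a n) \<longlonglongrightarrow> L * of_real 0"
    by (rule Lim_transform_eventually)
  from tendsto_diff[OF tendsto_const this, of 1] show ?thesis by simp
qed

text \<open>
  The exponent $p$ is the one for which the first order terms cancel: $a_n^k$ contributes
  $-kp/n$ and $((n+k+1)/(n+1))^p$ contributes $+kp/n$. The weight uses $n+1$ so that it does
  not vanish at $n = 0$.
\<close>

lemma rescaled_coefficient_asymptotics:
  fixes a :: "nat \<Rightarrow> complex"
  assumes "(\<lambda>n. of_nat n * (1 - a n)) \<longlonglongrightarrow> complex_of_real p"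
  shows "(\<lambda>n. of_nat (n + k) * (a n ^ k * of_real ((real (Suc (n + k)) / real (Suc n)) powr p) - 1)) \<longlonglongrightarrow> 0"
proof -
  define s where "s n = (real (Suc (n + k)) / real (Suc n)) powr p" for n
  note a1 = tendsto_one_of_first_order_limit[OF assms]
  have "(\<lambda>n. - (of_nat n * (1 - a n)) * (\<Sum>i<k. a n ^ i)) \<longlonglongrightarrow> - of_real p * (\<Sum>i<k. 1 ^ i)"
    by (intro tendsto_intros assms a1)
  moreover have "- (of_nat n * (1 - a n)) * (\<Sum>i<k. a n ^ i) = of_nat n * (a n ^ k - 1)" for n
    by (simp add: power_diff_1_eq algebra_simps)
  ultimately have A: "(\<lambda>n. of_nat n * (a n ^ k - 1)) \<longlonglongrightarrow> - of_real (p * real k)" by simp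
  have "(\<lambda>n. real n * (s n - 1)) \<longlonglongrightarrow> p * real k"
    unfolding s_def by real_asymp
  from tendsto_of_real[OF this, where 'a = complex]
  have S: "(\<lambda>n. of_nat n * (of_real (s n) - 1) :: complex) \<longlonglongrightarrow> of_real (p * real k)" by simp
  have "s \<longlonglongrightarrow> 1" unfolding s_def by real_asymp
  from tendsto_of_real[OF this, where 'a = complex]
  have s1: "(\<lambda>n. of_real (s n) :: complex) \<longlonglongrightarrow> 1" by simp
  \<comment> \<open>$n(AS-1) = n(A-1)S + n(S-1)$, and the extra factor $k$ in $n+k$ multiplies a null sequence.\<close>
  have "(\<lambda>n. of_nat n * (a n ^ k - 1) * of_real (s n) + of_nat n * (of_real (s n) - 1)
          + of_nat k * (a n ^ k * of_real (s n) - 1))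
      \<longlonglongrightarrow> - of_real (p * real k) * 1 + of_real (p * real k) + of_nat k * (1 ^ k * 1 - 1)"
    by (intro tendsto_intros A S s1 a1)
  then show ?thesis by (simp add: s_def algebra_simps)
qed

fun triangular_solution :: "(nat \<Rightarrow> nat \<Rightarrow> complex) \<Rightarrow> (nat \<Rightarrow> complex) \<Rightarrow> nat \<Rightarrow> complex" where
  "triangular_solution u d n = d n - (\<Sum>k\<in>{1..n}. u k (n - k) * triangular_solution u d (n - k))"

\<comment> \<open>The recursive equation applies to its own right-hand side, so rewriting with it would not end.\<close>
declare triangular_solution.simps [simp del]

lemma triangular_solution:
  assumes "\<And>n. u 0 n = 1"
  shows "(\<Sum>k\<le>n. u k (n - k) * triangular_solution u d (n - k)) = d n"
proof -
  have "{..n} = insert 0 {1..n}" by auto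
  then show ?thesis using assms triangular_solution.simps[of u d n] by simp
qed

text \<open>
  The growth lemma is applied to $(n+1)^p \alpha_n$. The factor gained by undoing this scaling,
  $(n+1)^{-p}$, is square summable with room to spare for the growth $(n+1)^t$.
\<close>

lemma square_summable_solution:
  fixes a :: "nat \<Rightarrow> complex" and P :: "complex poly"
  assumes inv: "fps_of_poly P * G = 1" and bdd: "\<And>n. norm (fps_nth G n) \<le> C"
    and lim: "(\<lambda>n. of_nat n * (1 - a n)) \<longlonglongrightarrow> complex_of_real p" and "p > 1/2"
    and rec: "\<And>n. (\<Sum>k\<le>n. coeff P k * a (n - k) ^ k * \<alpha> (n - k)) = d n"
    and d: "eventually (\<lambda>n. d n = 0) sequentially"
  shows "summable (\<lambda>n. (norm (\<alpha> n))\<^sup>2)"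
proof -
  define w where "w n = real (Suc n) powr p" for n
  define r where "r k n = a n ^ k * of_real ((real (Suc (n + k)) / real (Suc n)) powr p)" for k n
  \<comment> \<open>Any growth exponent strictly between \<open>0\<close> and \<open>p - 1/2\<close> will do.\<close>
  define t where "t = (p - 1/2) / 2"
  have t: "t > 0" "2 * (t - p) < -1" using \<open>p > 1/2\<close> by (simp_all add: t_def field_simps)
  have w0: "w n > 0" for n by (simp add: w_def)
  have rw: "of_real (w (n - k)) * r k (n - k) = a (n - k) ^ k * of_real (w n)" if "k \<le> n" for n k
    using that by (simp add: r_def w_def powr_divide)
  obtain K where K: "norm (of_real (w n) * \<alpha> n) \<le> K * real (Suc n) powr t" for n
  proof (rule perturbed_recurrence_growth[OF inv bdd])
    show "r 0 n = 1" for n by (simp add: r_def)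
    show "(\<lambda>n. of_nat (n + k) * (r k n - 1)) \<longlonglongrightarrow> 0" for k
      unfolding r_def by (rule rescaled_coefficient_asymptotics[OF lim])
    show "(\<Sum>k\<le>n. coeff P k * r k (n - k) * (of_real (w (n - k)) * \<alpha> (n - k))) = of_real (w n) * d n" for n
      unfolding rec[symmetric] sum_distrib_left using rw
      by (intro sum.cong) (auto simp: mult_ac)
    show "eventually (\<lambda>n. of_real (w n) * d n = 0) sequentially"
      using d by eventually_elim simp
  qed (use t in auto)
  have bound: "(norm (\<alpha> n))\<^sup>2 \<le> K\<^sup>2 * real (Suc n) powr (2 * (t - p))" for n
  proof -
    have "norm (\<alpha> n) \<le> K * real (Suc n) powr t / w n"
      using K[of n] w0[of n] by (simp add: norm_mult pos_le_divide_eq mult.commute)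
    also have "\<dots> = K * real (Suc n) powr (t - p)" by (simp add: w_def powr_diff)
    finally have "(norm (\<alpha> n))\<^sup>2 \<le> (K * real (Suc n) powr (t - p))\<^sup>2" by (intro power_mono) auto
    then show ?thesis by (simp add: power_mult_distrib powr_power mult.commute)
  qed
  have "summable (\<lambda>n. real n powr (2 * (t - p)))" using t by (simp add: summable_real_powr_iff)
  then have "summable (\<lambda>n. K\<^sup>2 * real (Suc n) powr (2 * (t - p)))"
    by (intro summable_mult) (subst summable_Suc_iff)
  then show ?thesis
    by (rule summable_comparison_test[rotated]) (use bound in auto)
qed

section \<open>From the coefficient recurrence to the expansion\<close>

text \<open>
  Expanding \<open>P\<close> turns the general term into finitely many multiples \<open>u k n\<close> of \<open>w ^ (n + k)\<close>.
  Delaying the \<open>k\<close>-th series by \<open>k\<close> places (\<open>v k\<close>) does not change its sum, but aligns the powers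
  of \<open>w\<close>, after which \<open>rec\<close> evaluates the sum over \<open>k\<close> for each power.
\<close>

lemma triangular_rearrangement_sums:
  fixes \<alpha> a :: "nat \<Rightarrow> complex" and P q :: "complex poly"
  assumes "Bseq \<alpha>" "Bseq a" "norm w < 1"
    and rec: "\<And>n. (\<Sum>k\<le>n. coeff P k * a (n - k) ^ k * \<alpha> (n - k)) = coeff q n"
  shows "(\<lambda>n. \<alpha> n * (poly P (a n * w) * w ^ n)) sums poly q w"
proof -
  define u where "u k n = coeff P k * a n ^ k * \<alpha> n * w ^ (n + k)" for k n
  define v where "v k n = (if k \<le> n then u k (n - k) else 0)" for k n
  obtain A where A: "\<And>n. norm (\<alpha> n) \<le> A" using \<open>Bseq \<alpha>\<close> unfolding Bseq_def by blast
  obtain B where B: "\<And>n. norm (a n) \<le> B" using \<open>Bseq a\<close> unfolding Bseq_def by blast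
  have "summable (u k)" for k
  proof (rule summable_comparison_test)
    have "B \<ge> 0" using B[of 0] norm_ge_zero order_trans by blast
    then have "norm (u k n) \<le> norm (coeff P k) * B ^ k * A * (norm w ^ n * norm w ^ k)" for n
      unfolding u_def norm_mult norm_power power_add
      using A B by (intro mult_mono power_mono mult_nonneg_nonneg)
        (auto intro: order_trans[OF norm_ge_zero])
    then show "\<exists>N. \<forall>n\<ge>N. norm (u k n) \<le> norm (coeff P k) * B ^ k * A * (norm w ^ n * norm w ^ k)"
      by blast
    show "summable (\<lambda>n. norm (coeff P k) * B ^ k * A * (norm w ^ n * norm w ^ k))"
      using \<open>norm w < 1\<close> by (intro summable_mult summable_mult2 summable_geometric) simp
  qed
  then have us: "u k sums suminf (u k)" for k by (rule summable_sums)
  have vs: "v k sums suminf (u k)" for k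
  proof -
    have "(\<lambda>n. v k (n + k)) sums suminf (u k)" using us[of k] by (simp add: v_def)
    then show ?thesis by (subst (asm) sums_zero_iff_shift) (auto simp: v_def)
  qed
  have "(\<lambda>n. \<Sum>k\<le>degree P. u k n) sums (\<Sum>k\<le>degree P. suminf (u k))"
    by (intro sums_sum us)
  moreover have "(\<Sum>k\<le>degree P. u k n) = \<alpha> n * (poly P (a n * w) * w ^ n)" for n
    by (simp add: u_def poly_altdef sum_distrib_left sum_distrib_right power_mult_distrib power_add mult_ac)
  moreover have "(\<lambda>n. \<Sum>k\<le>degree P. v k n) sums (\<Sum>k\<le>degree P. suminf (u k))"
    by (intro sums_sum vs)
  moreover have "(\<Sum>k\<le>degree P. v k n) = coeff q n * w ^ n" for n
  proof -
    have "(\<Sum>k\<le>degree P. v k n) = (\<Sum>k\<le>max n (degree P). v k n)"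
      by (intro sum.mono_neutral_left) (auto simp: v_def u_def coeff_eq_0)
    also have "\<dots> = (\<Sum>k\<le>n. v k n)"
      by (intro sum.mono_neutral_right) (auto simp: v_def)
    also have "\<dots> = coeff q n * w ^ n"
      unfolding rec[symmetric] sum_distrib_right by (intro sum.cong) (auto simp: v_def u_def)
    finally show ?thesis .
  qed
  moreover have "(\<lambda>n. coeff q n * w ^ n) sums poly q w"
    unfolding poly_altdef by (rule sums_finite) (auto simp: coeff_eq_0)
  ultimately show ?thesis by (simp add: sums_iff)
qed

theorem corollary18:
  fixes J :: nat and z a :: "nat \<Rightarrow> complex" and p :: real
  assumes "J \<ge> 1"
    and "\<And>j. j \<in> {1..J} \<Longrightarrow> norm (z j) = 1"
    and "inj_on z {1..J}"
    and "\<And>n. a n \<noteq> 1"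
    and "p > 1/2"
    and "(\<lambda>n. of_nat n * (1 - a n)) \<longlonglongrightarrow> complex_of_real p"
  shows "\<forall>q :: complex poly. restrict (poly q) (ball 0 1) \<in> HK (basis_fun J z a)"
proof
  fix q :: "complex poly"
  define P where "P = (\<Prod>j\<in>{1..J}. [:1, - cnj (z j):])"
  have phi: "phi J z w = poly P w" for w
    by (simp add: phi_def P_def poly_prod mult.commute)
  have "inj_on (\<lambda>j. cnj (z j)) {1..J}"
    using assms(3) unfolding inj_on_def complex_cnj_cancel_iff .
  moreover have "{1..J} \<noteq> {}" using assms(1) by auto
  ultimately obtain G C where G: "fps_of_poly P * G = 1" "\<And>n. norm (fps_nth G n) \<le> C"
    using bounded_reciprocal_of_unimodular_roots[of "{1..J}" "\<lambda>j. cnj (z j)"] assms(2)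
    unfolding P_def complex_mod_cnj by (metis finite_atLeastAtMost)
  have P0: "coeff P 0 = 1"
    by (simp add: P_def poly_0_coeff_0[symmetric] poly_prod)
  define \<alpha> where "\<alpha> = triangular_solution (\<lambda>k n. coeff P k * a n ^ k) (coeff q)"
  have rec: "(\<Sum>k\<le>n. coeff P k * a (n - k) ^ k * \<alpha> (n - k)) = coeff q n" for n
    unfolding \<alpha>_def by (rule triangular_solution) (simp add: P0)
  have "eventually (\<lambda>n. coeff q n = 0) sequentially"
    using eventually_gt_at_top[of "degree q"] by eventually_elim (rule coeff_eq_0)
  from square_summable_solution[OF G assms(6,5) rec this]
  have sq: "summable (\<lambda>n. (norm (\<alpha> n))\<^sup>2)" .
  have "(\<lambda>n. (norm (\<alpha> n))\<^sup>2) \<longlonglongrightarrow> 0" using sq by (rule summable_LIMSEQ_zero)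
  then have "\<alpha> \<longlonglongrightarrow> 0" by (simp add: tendsto_norm_zero_iff)
  then have "Bseq \<alpha>" by (intro convergent_imp_Bseq convergentI)
  have "Bseq a"
    using tendsto_one_of_first_order_limit[OF assms(6)] by (intro convergent_imp_Bseq convergentI)
  have "(\<lambda>n. \<alpha> n * basis_fun J z a n w) sums poly q w" if "norm w < 1" for w
    unfolding basis_fun_def phi
    by (rule triangular_rearrangement_sums[OF \<open>Bseq \<alpha>\<close> \<open>Bseq a\<close> that rec])
  then show "restrict (poly q) (ball 0 1) \<in> HK (basis_fun J z a)"
    using sq by (auto simp: HK_def)
qed

end
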